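(* Let $G$ be a simple connected graph with vertex set $V(G)$, and let $\Omega(G)$ be the set of Gallai-indices of $G$. Then for every $F=\{v_1,v_2,v_3\}\in\Omega(G)$ there exists $H\in\Omega(G)$ such that $|F\cap H|=|H|-1$.
   Context: $G$ is a finite simple graph with vertex set $V(G)=[n]=\{1,\dots,n\}$ and edge set $E(G)$; write $e_{i,j}=\{i,j\}$ for an edge. The Gallai graph $\Gamma(G)$ is the graph whose vertex set is $E(G)$; two distinct edges of $G$ are adjacent in $\Gamma(G)$ if they are incident in $G$ (share a vertex) but do not span a triangle in $G$. The set of Gallai-indices $\Omega(G)$ is the collection of the following subsets of $V(G)$: $F_{i,j,k}=\{i,j,k\}$ whenever $e_{i,j}$ and $e_{j,k}$ are adjacent in $\Gamma(G)$, and $F_{i,j}=\{i,j\}$ whenever $e_{i,j}$ is an isolated vertex of $\Gamma(G)$.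
   Formalization: The formal statement assumes that G does not have exactly three vertices: for the path 1-2-3 the only Gallai-index is {1,2,3}, so the claim fails there, and the triangle, the only other connected graph on three vertices, has no three-element Gallai-index. *)

theory Defs
  imports Main
begin

type_synonym 'a sgraph = "'a set \<times> 'a set set"

abbreviation verts :: "'a sgraph \<Rightarrow> 'a set" where "verts G \<equiv> fst G"
abbreviation edges :: "'a sgraph \<Rightarrow> 'a set set" where "edges G \<equiv> snd G"

definition simple_graph :: "'a sgraph \<Rightarrow> bool" where
  "simple_graph G \<longleftrightarrow> finite (verts G) \<and> (\<forall>e\<in>edges G. e \<subseteq> verts G \<and> card e = 2)"

definition adjacent :: "'a sgraph \<Rightarrow> 'a \<Rightarrow> 'a \<Rightarrow> bool" where
  "adjacent G x y \<longleftrightarrow> {x, y} \<in> edges G"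

definition isolated :: "'a sgraph \<Rightarrow> 'a \<Rightarrow> bool" where
  "isolated G x \<longleftrightarrow> x \<in> verts G \<and> (\<forall>y\<in>verts G. \<not> adjacent G x y)"

definition connected_graph :: "'a sgraph \<Rightarrow> bool" where
  "connected_graph G \<longleftrightarrow>
     verts G \<noteq> {} \<and> (\<forall>x\<in>verts G. \<forall>y\<in>verts G. (adjacent G)\<^sup>*\<^sup>* x y)"

definition spans_triangle :: "'a sgraph \<Rightarrow> 'a set \<Rightarrow> 'a set \<Rightarrow> bool" where
  "spans_triangle G e f \<longleftrightarrow>
     card (e \<union> f) = 3 \<and> (\<forall>x\<in>e \<union> f. \<forall>y\<in>e \<union> f. x \<noteq> y \<longrightarrow> adjacent G x y)"

definition gallai_graph :: "'a sgraph \<Rightarrow> 'a set sgraph" where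
  "gallai_graph G =
     (edges G,
      {{e, f} | e f. e \<in> edges G \<and> f \<in> edges G \<and> e \<noteq> f \<and> e \<inter> f \<noteq> {} \<and> \<not> spans_triangle G e f})"

definition gallai_indices :: "'a sgraph \<Rightarrow> 'a set set" where
  "gallai_indices G =
     {{i, j, k} | i j k. adjacent (gallai_graph G) {i, j} {j, k}}
     \<union> {{i, j} | i j. isolated (gallai_graph G) {i, j}}"

text \<open>The path with three vertices has a single Gallai-index \<open>{1, 2, 3}\<close>, and no index \<open>H\<close>
  meets it in \<open>|H| - 1\<close> vertices. Any claim that such an \<open>H\<close> exists therefore has to exclude this graph.
  The only other connected graph with three vertices, the triangle, has no three-element
  Gallai-index, so it is enough to exclude \<open>n = 3\<close>.\<close>

lemma path3_counterexample:
  fixes G :: "nat sgraph"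
  defines "G \<equiv> ({1..3}, {{1, 2}, {2, 3}})"
  shows "simple_graph G" "connected_graph G" "{1, 2, 3} \<in> gallai_indices G"
    "\<not> (\<exists>H\<in>gallai_indices G. int (card ({1, 2, 3} \<inter> H)) = int (card H) - 1)"
proof -
  have vG: "verts G = {1, 2, 3}" and eG: "edges G = {{1, 2}, {2, 3}}" by (auto simp: G_def)
  show "simple_graph G" by (simp add: simple_graph_def vG eG)
  have a: "adjacent G 1 2" "adjacent G 2 1" "adjacent G 2 3" "adjacent G 3 2"
    by (simp_all add: adjacent_def eG doubleton_eq_iff)
  have "(adjacent G)\<^sup>*\<^sup>* 1 3" "(adjacent G)\<^sup>*\<^sup>* 3 1"
    by (rule rtranclp_trans[OF r_into_rtranclp r_into_rtranclp], rule a, rule a)+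
  with a show "connected_graph G"
    by (simp add: connected_graph_def vG r_into_rtranclp)
  have "\<not> adjacent G 1 3" by (simp add: adjacent_def eG doubleton_eq_iff)
  then have nt: "\<not> spans_triangle G {1, 2} {2, 3}" by (simp add: spans_triangle_def)
  have "{1, 2} \<in> edges G" "{2, 3} \<in> edges G" "{1, 2} \<noteq> {2, 3::nat}"
    "{1, 2} \<inter> {2, 3::nat} \<noteq> {}"
    by (simp_all add: eG doubleton_eq_iff)
  with nt have gadj: "adjacent (gallai_graph G) {1, 2} {2, 3}"
    unfolding adjacent_def gallai_graph_def snd_conv by blast
  then show "{1, 2, 3} \<in> gallai_indices G"
    unfolding gallai_indices_def by blast
  have only: "H = {1, 2, 3}" if H: "H \<in> gallai_indices G" for H
  proof -
    consider i j k where "H = {i, j, k}" "adjacent (gallai_graph G) {i, j} {j, k}"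
      | i j where "H = {i, j}" "isolated (gallai_graph G) {i, j}"
      using H unfolding gallai_indices_def by blast
    then show ?thesis
    proof cases
      case 1
      then obtain e f where ef: "{{i, j}, {j, k}} = {e, f}" "e \<in> edges G" "f \<in> edges G" "e \<noteq> f"
        unfolding adjacent_def gallai_graph_def snd_conv mem_Collect_eq by (elim exE conjE)
      then have "e = {1, 2} \<and> f = {2, 3} \<or> e = {2, 3} \<and> f = {1, 2}"
        unfolding eG by (metis insertE singletonD)
      then have "e \<union> f = {1, 2, 3}" by (elim disjE conjE; simp add: insert_commute)
      moreover have "e \<union> f = {i, j, k}"
        using arg_cong[OF ef(1), of Union] by (simp add: insert_commute)
      ultimately show ?thesis using 1 by simp
    next
      case 2
      have "adjacent (gallai_graph G) {2, 3} {1, 2}"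
        using gadj by (simp only: adjacent_def insert_commute)
      with gadj 2(2) have False
        unfolding isolated_def gallai_graph_def[of G, THEN arg_cong, of fst] fst_conv eG
        by (elim conjE) (metis insertE insertI1 insert_commute singletonD)
      then show ?thesis ..
    qed
  qed
  show "\<not> (\<exists>H\<in>gallai_indices G. int (card ({1, 2, 3} \<inter> H)) = int (card H) - 1)"
  proof
    assume "\<exists>H\<in>gallai_indices G. int (card ({1, 2, 3} \<inter> H)) = int (card H) - 1"
    then obtain H where "H \<in> gallai_indices G" "int (card ({1, 2, 3} \<inter> H)) = int (card H) - 1" ..
    with only[of H] show False by simp
  qed
qed

end

theory Submission
  imports Defs
begin

text \<open>A three-element Gallai-index is the vertex set of an induced path \<open>a - b - c\<close>, and conversely
  every induced path on three vertices gives one (\<open>induced_path_gallai_index\<close>,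
  \<open>gallai_index_induced_path\<close>). If the connected graph has a vertex outside \<open>F = {a, b, c}\<close>, then
  some vertex \<open>d\<close> outside \<open>F\<close> has a neighbour in \<open>F\<close>. Whatever the neighbours of \<open>d\<close> in \<open>F\<close> are, \<open>d\<close>
  together with two vertices of \<open>F\<close> spans an induced path: if \<open>d\<close> sees exactly one of \<open>a\<close> and \<open>b\<close>, the
  set \<open>{d, a, b}\<close> works; if \<open>d\<close> sees exactly one of \<open>b\<close> and \<open>c\<close>, the set \<open>{d, b, c}\<close> works; otherwise
  \<open>d\<close> sees all three, and \<open>{a, d, c}\<close> works. This set is an \<open>H\<close> with \<open>|H| = 3\<close> and
  \<open>|F \<inter> H| = 2\<close>.\<close>

lemma adjacent_sym: "adjacent G x y \<longleftrightarrow> adjacent G y x"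
  by (simp add: adjacent_def insert_commute)

lemma adjacent_verts:
  assumes "simple_graph G" "adjacent G x y"
  shows "x \<in> verts G" "y \<in> verts G" "x \<noteq> y"
proof -
  have "{x, y} \<subseteq> verts G" "card {x, y} = 2"
    using assms by (auto simp: simple_graph_def adjacent_def)
  then show "x \<in> verts G" "y \<in> verts G" "x \<noteq> y" by auto
qed

lemma gallai_graph_adjacent_iff:
  "adjacent (gallai_graph G) e f \<longleftrightarrow>
     e \<in> edges G \<and> f \<in> edges G \<and> e \<noteq> f \<and> e \<inter> f \<noteq> {} \<and> \<not> spans_triangle G e f"
proof
  assume "adjacent (gallai_graph G) e f"
  then obtain e' f' where ef: "{e, f} = {e', f'}" and e'f': "e' \<in> edges G" "f' \<in> edges G"
      "e' \<noteq> f'" "e' \<inter> f' \<noteq> {}" "\<not> spans_triangle G e' f'"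
    unfolding adjacent_def gallai_graph_def snd_conv mem_Collect_eq by (elim exE conjE)
  have "spans_triangle G e' f' = spans_triangle G f' e'" "e' \<inter> f' = f' \<inter> e'"
    by (simp_all only: spans_triangle_def Un_commute Int_commute)
  with e'f' have "f' \<in> edges G \<and> e' \<in> edges G \<and> f' \<noteq> e' \<and> f' \<inter> e' \<noteq> {} \<and>
      \<not> spans_triangle G f' e'"
    by simp
  moreover have "e = e' \<and> f = f' \<or> e = f' \<and> f = e'"
    using ef by (simp add: doubleton_eq_iff)
  ultimately show "e \<in> edges G \<and> f \<in> edges G \<and> e \<noteq> f \<and> e \<inter> f \<noteq> {} \<and>
      \<not> spans_triangle G e f"
    using e'f' by (elim disjE conjE) simp_all
next
  assume "e \<in> edges G \<and> f \<in> edges G \<and> e \<noteq> f \<and> e \<inter> f \<noteq> {} \<and> \<not> spans_triangle G e f"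
  then show "adjacent (gallai_graph G) e f"
    unfolding adjacent_def gallai_graph_def snd_conv by blast
qed

lemma induced_path_gallai_index:
  assumes "adjacent G i j" "adjacent G j k" "\<not> adjacent G i k" "i \<noteq> k"
  shows "{i, j, k} \<in> gallai_indices G"
proof -
  have "\<not> spans_triangle G {i, j} {j, k}"
    using assms(3,4) by (auto simp: spans_triangle_def)
  moreover have "{i, j} \<noteq> {j, k}"
    using assms(4) by (auto simp: doubleton_eq_iff)
  ultimately have "adjacent (gallai_graph G) {i, j} {j, k}"
    using assms(1,2)[unfolded adjacent_def] by (simp add: gallai_graph_adjacent_iff)
  then show ?thesis
    unfolding gallai_indices_def by blast
qed

lemma gallai_index_induced_path:
  assumes "F \<in> gallai_indices G" "card F = 3"
  obtains i j k where "F = {i, j, k}" "distinct [i, j, k]"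
    "adjacent G i j" "adjacent G j k" "\<not> adjacent G i k"
proof -
  have "card {i, j} \<noteq> 3" for i j :: 'a
    by (cases "i = j") auto
  then obtain i j k where F: "F = {i, j, k}" and adj: "adjacent (gallai_graph G) {i, j} {j, k}"
    using assms unfolding gallai_indices_def by blast
  have dist: "distinct [i, j, k]"
    using assms(2) by (auto simp: F card_insert_if split: if_splits)
  have edges: "adjacent G i j" "adjacent G j k"
    and "\<not> spans_triangle G {i, j} {j, k}"
    using adj unfolding gallai_graph_adjacent_iff by (simp_all add: adjacent_def)
  moreover have "{i, j} \<union> {j, k} = {i, j, k}" by auto
  ultimately have "\<not> adjacent G i k"
    using dist by (auto simp: spans_triangle_def adjacent_sym)
  with F dist edges show ?thesis by (rule that)
qed

lemma rtranclp_leaves_set: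
  assumes "r\<^sup>*\<^sup>* a b" "a \<in> S" "b \<notin> S"
  obtains x y where "x \<in> S" "y \<notin> S" "r x y"
  using assms by (induction rule: rtranclp_induct) blast+

lemma gallai_index_neighbour:
  assumes G: "simple_graph G" "connected_graph G"
    and F: "F \<in> gallai_indices G" "card F = 3" and big: "card (verts G) \<noteq> 3"
  obtains H where "H \<in> gallai_indices G" "card H = 3" "card (F \<inter> H) = 2"
proof -
  obtain a b c where abc: "F = {a, b, c}" "distinct [a, b, c]"
    "adjacent G a b" "adjacent G b c" "\<not> adjacent G a c"
    using F by (rule gallai_index_induced_path)
  have "F \<subseteq> verts G"
    using abc adjacent_verts[OF G(1)] by auto
  moreover have "F \<noteq> verts G" using F(2) big by auto
  ultimately obtain w where w: "w \<in> verts G" "w \<notin> F" by auto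
  have "(adjacent G)\<^sup>*\<^sup>* a w"
    using G(2) \<open>F \<subseteq> verts G\<close> w(1) abc(1) by (auto simp: connected_graph_def)
  moreover have "a \<in> F" using abc(1) by simp
  ultimately obtain x d where x: "x \<in> F" and d: "d \<notin> F" and xd: "adjacent G x d"
    using w(2) by (rule rtranclp_leaves_set)
  have d': "d \<noteq> a" "d \<noteq> b" "d \<noteq> c" using d abc(1) by auto
  have sees: "adjacent G d a \<or> adjacent G d b \<or> adjacent G d c"
    using x xd abc(1) by (auto simp: adjacent_sym)
  have "{a, b, d} \<in> gallai_indices G \<or> {b, c, d} \<in> gallai_indices G \<or> {a, c, d} \<in> gallai_indices G"
  proof -
    consider "adjacent G d a \<noteq> adjacent G d b" | "adjacent G d b \<noteq> adjacent G d c"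
      | "adjacent G d a" "adjacent G d c"
      using sees by blast
    then show ?thesis
    proof cases
      case 1
      then show ?thesis
        using abc(3) d' induced_path_gallai_index[of G d a b] induced_path_gallai_index[of G d b a]
        by (auto simp: insert_commute adjacent_sym)
    next
      case 2
      then show ?thesis
        using abc(4) d' induced_path_gallai_index[of G d b c] induced_path_gallai_index[of G d c b]
        by (auto simp: insert_commute adjacent_sym)
    next
      case 3
      then show ?thesis
        using abc(2,5) induced_path_gallai_index[of G a d c]
        by (auto simp: insert_commute adjacent_sym)
    qed
  qed
  moreover have "F \<inter> {a, b, d} = {a, b}" "F \<inter> {b, c, d} = {b, c}" "F \<inter> {a, c, d} = {a, c}"
    using abc(1) d by auto
  moreover have "card {a, b, d} = 3" "card {b, c, d} = 3" "card {a, c, d} = 3"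
    "card {a, b} = 2" "card {b, c} = 2" "card {a, c} = 2"
    using abc(2) d' by auto
  ultimately show ?thesis using that by metis
qed

theorem lemma4p7:
  fixes n :: nat and G :: "nat sgraph" and F :: "nat set" and v1 v2 v3 :: nat
  assumes "simple_graph G"
    and "verts G = {1..n}"
    and "connected_graph G"
    and "n \<noteq> 3"
    and "F \<in> gallai_indices G"
    and "F = {v1, v2, v3}"
    and "distinct [v1, v2, v3]"
  shows "\<exists>H\<in>gallai_indices G. int (card (F \<inter> H)) = int (card H) - 1"
proof -
  have "card F = 3" "card (verts G) \<noteq> 3"
    using assms(2,4,6,7) by auto
  with assms(1,3,5) obtain H
    where "H \<in> gallai_indices G" "card H = 3" "card (F \<inter> H) = 2"
    by (rule gallai_index_neighbour)
  then show ?thesis by (intro bexI[of _ H]) simp_all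
qed

end
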